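(* Let $G$ be a graph, let $u,v$ be two distinct vertices of $G$, and suppose that $H=G\setminus\{v,u\}$ is a unique subgraph (an anchor) of $G$. Let $N_{v,H}=N(v)\cap V(H)$. If $\alpha(N_{v,H})=N_{v,H}$ for every $\alpha\in\mathrm{Aut}(H)$, then $G$ is reconstructible.
   Context: All graphs are finite and simple; subgraphs are vertex-induced. $N(v)$ is the set of neighbors of $v$ in $G$. A unique subgraph, or anchor, of $G$ is a proper nonempty induced subgraph $H$ that occurs exactly once in $G$: no vertex set $W\neq V(H)$ satisfies $G[W]\cong H$. The deck of $G$ is the multiset of isomorphism classes of the graphs $G\setminus x$, $x\in V(G)$; $G$ is reconstructible if every graph with the same deck as $G$ is isomorphic to $G$. *)

theory Defs
  imports "Graph_Theory.Graph_Theory" "HOL-Library.Multiset"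
begin

text \<open>
  Finite simple graphs are given by the locale \<open>graph\<close>, that is, finite symmetric digraphs
  without loops and without parallel arcs; each undirected edge is a pair of opposite arcs.
\<close>

definition neighbors :: "('a, 'b) pre_digraph \<Rightarrow> 'a \<Rightarrow> 'a set" where
  "neighbors G v = {w. v \<rightarrow>\<^bsub>G\<^esub> w}"

text \<open>
  Automorphisms are recorded by their action on vertices; the values outside \<open>verts H\<close>
  are unconstrained.
\<close>

definition Aut :: "('a, 'b) pre_digraph \<Rightarrow> ('a \<Rightarrow> 'a) set" where
  "Aut H = {iso_verts f | f. pre_digraph.digraph_isomorphism H f \<and> app_iso f H = H}"

definition anchor :: "('a, 'b) pre_digraph \<Rightarrow> ('a, 'b) pre_digraph \<Rightarrow> bool" where
  "anchor G H \<longleftrightarrow> induced_subgraph H G \<and> verts H \<noteq> {} \<and> verts H \<subset> verts G \<and>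
     (\<forall>W. W \<subseteq> verts G \<and> W \<noteq> verts H \<longrightarrow> \<not> digraph_iso (G \<restriction> W) H)"

text \<open>
  Isomorphism classes are taken among graphs with vertices in \<open>nat\<close>, so that decks of graphs
  over different types are comparable. Nothing is lost, since every finite graph has a copy there
  (see \<open>ex_nat_copy\<close>, \<open>iso_class_eq_iff\<close> and \<open>reconstructibleD\<close> below).
\<close>

definition iso_class :: "('a, 'b) pre_digraph \<Rightarrow> (nat, nat \<times> nat) pre_digraph set" where
  "iso_class G = {K. graph K \<and> digraph_iso G K}"

definition deck :: "('a, 'b) pre_digraph \<Rightarrow> (nat, nat \<times> nat) pre_digraph set multiset" where
  "deck G = {# iso_class (pre_digraph.del_vert G x). x \<in># mset_set (verts G) #}"

definition reconstructible :: "('a, 'b) pre_digraph \<Rightarrow> bool" where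
  "reconstructible G \<longleftrightarrow>
     (\<forall>K :: (nat, nat \<times> nat) pre_digraph. graph K \<and> deck K = deck G \<longrightarrow> digraph_iso K G)"

lemma graph_del_vert:
  assumes "graph G"
  shows "graph (pre_digraph.del_vert G x)"
proof -
  interpret graph G by fact
  have s: "e \<in> arcs G \<Longrightarrow> \<exists>e'\<in>arcs G. tail G e' = head G e \<and> head G e' = tail G e" for e
    using sym_arcs
    by (force simp: symmetric_def sym_def arcs_ends_def arc_to_ends_def image_iff)
  show ?thesis
    apply unfold_locales
    subgoal by (auto simp: del_vert_def)
    subgoal by (auto simp: del_vert_def)
    subgoal by (auto simp: del_vert_def)
    subgoal by (auto simp: del_vert_def)
    subgoal by (auto simp: del_vert_def dest: no_loops)
    subgoal using no_multi_arcs by (auto simp: del_vert_def arc_to_ends_def)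
    subgoal
      unfolding symmetric_def
      apply (rule symI)
      apply (clarsimp simp: arcs_ends_def arc_to_ends_def del_vert_def)
      apply (drule s)
      apply (force simp: image_iff)
      done
    done
qed

lemma arcs_ends_del_vert:
  "arcs_ends (pre_digraph.del_vert G z) = {(x, y) \<in> arcs_ends G. x \<noteq> z \<and> y \<noteq> z}"
  by (auto simp: arcs_ends_def arc_to_ends_def pre_digraph.del_vert_def)

lemma arcs_ends_app_iso:
  assumes "pre_digraph.digraph_isomorphism G f"
  shows "arcs_ends (app_iso f G) = map_prod (iso_verts f) (iso_verts f) ` arcs_ends G"
  using assms
  by (auto simp: arcs_ends_def arc_to_ends_def pre_digraph.digraph_isomorphism_def image_iff
      intro!: bexI)

lemma digraph_iso_iff:
  assumes "graph G" "graph K"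
  shows "digraph_iso G K \<longleftrightarrow>
    (\<exists>f. bij_betw f (verts G) (verts K) \<and>
         (\<forall>x\<in>verts G. \<forall>y\<in>verts G. x \<rightarrow>\<^bsub>G\<^esub> y \<longleftrightarrow> f x \<rightarrow>\<^bsub>K\<^esub> f y))"
proof -
  interpret G: graph G by fact
  interpret K: graph K by fact
  have injK: "inj_on (arc_to_ends K) (arcs K)"
    by (rule inj_onI) (rule K.no_multi_arcs)
  show ?thesis
  proof
    assume "digraph_iso G K"
    then obtain h where h: "pre_digraph.digraph_isomorphism G h" and K: "K = app_iso h G"
      by (auto simp: digraph_iso_def)
    have inj: "inj_on (iso_verts h) (verts G)"
      using h by (auto simp: pre_digraph.digraph_isomorphism_def)
    have "x \<rightarrow>\<^bsub>G\<^esub> y \<longleftrightarrow> iso_verts h x \<rightarrow>\<^bsub>K\<^esub> iso_verts h y"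
      if "x \<in> verts G" "y \<in> verts G" for x y
    proof -
      have sub: "arcs_ends G \<subseteq> verts G \<times> verts G"
        by (auto simp: arcs_ends_def arc_to_ends_def)
      show ?thesis
        unfolding K arcs_ends_app_iso[OF h]
      proof
        assume "(x, y) \<in> arcs_ends G"
        then show "(iso_verts h x, iso_verts h y) \<in> map_prod (iso_verts h) (iso_verts h) ` arcs_ends G"
          by (rule map_prod_imageI)
      next
        assume "(iso_verts h x, iso_verts h y) \<in> map_prod (iso_verts h) (iso_verts h) ` arcs_ends G"
        then obtain x' y' where *: "(x', y') \<in> arcs_ends G"
          "iso_verts h x = iso_verts h x'" "iso_verts h y = iso_verts h y'" by auto
        then have "x = x'" "y = y'" using inj_onD[OF inj] that sub by blast+
        with * show "(x, y) \<in> arcs_ends G" by simp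
      qed
    qed
    moreover have "bij_betw (iso_verts h) (verts G) (verts K)"
      using inj by (simp add: K bij_betw_def)
    ultimately show "\<exists>f. bij_betw f (verts G) (verts K) \<and>
         (\<forall>x\<in>verts G. \<forall>y\<in>verts G. x \<rightarrow>\<^bsub>G\<^esub> y \<longleftrightarrow> f x \<rightarrow>\<^bsub>K\<^esub> f y)" by blast
  next
    assume "\<exists>f. bij_betw f (verts G) (verts K) \<and>
         (\<forall>x\<in>verts G. \<forall>y\<in>verts G. x \<rightarrow>\<^bsub>G\<^esub> y \<longleftrightarrow> f x \<rightarrow>\<^bsub>K\<^esub> f y)"
    then obtain f where f: "bij_betw f (verts G) (verts K)"
      and adj: "\<And>x y. x \<in> verts G \<Longrightarrow> y \<in> verts G \<Longrightarrow> x \<rightarrow>\<^bsub>G\<^esub> y \<longleftrightarrow> f x \<rightarrow>\<^bsub>K\<^esub> f y" by blast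
    define g where "g a = inv_into (arcs K) (arc_to_ends K) (f (tail G a), f (head G a))" for a
    have ends: "(f (tail G a), f (head G a)) \<in> arc_to_ends K ` arcs K" if "a \<in> arcs G" for a
    proof -
      have "tail G a \<rightarrow>\<^bsub>G\<^esub> head G a"
        using that by (auto simp: arcs_ends_def arc_to_ends_def)
      then show ?thesis using adj[of "tail G a" "head G a"] that by (simp add: arcs_ends_def)
    qed
    have gK: "g a \<in> arcs K" if "a \<in> arcs G" for a
      unfolding g_def by (rule inv_into_into) (rule ends[OF that])
    have ge: "arc_to_ends K (g a) = (f (tail G a), f (head G a))" if "a \<in> arcs G" for a
      unfolding g_def by (rule f_inv_into_f) (rule ends[OF that])
    have injf: "inj_on f (verts G)" using f by (simp add: bij_betw_def)
    have injg: "inj_on g (arcs G)"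
    proof (rule inj_onI)
      fix a b assume ab: "a \<in> arcs G" "b \<in> arcs G" "g a = g b"
      then have "f (tail G a) = f (tail G b)" "f (head G a) = f (head G b)"
        using ge[of a] ge[of b] by auto
      then have "tail G a = tail G b" "head G a = head G b"
        using injf ab by (auto dest: inj_onD)
      then show "a = b" using ab G.no_multi_arcs by (auto simp: arc_to_ends_def)
    qed
    have surj: "g ` arcs G = arcs K"
    proof
      show "g ` arcs G \<subseteq> arcs K" using gK by blast
      show "arcs K \<subseteq> g ` arcs G"
      proof
        fix b assume b: "b \<in> arcs K"
        then have "tail K b \<in> f ` verts G" "head K b \<in> f ` verts G"
          using f by (auto simp: bij_betw_def)
        then obtain x y where xy: "x \<in> verts G" "y \<in> verts G" "tail K b = f x" "head K b = f y"
          by blast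
        have "f x \<rightarrow>\<^bsub>K\<^esub> f y"
          using b xy(3,4)[symmetric] by (auto simp: arcs_ends_def arc_to_ends_def)
        then have "x \<rightarrow>\<^bsub>G\<^esub> y" using adj xy by blast
        then obtain a where a: "a \<in> arcs G" "tail G a = x" "head G a = y"
          by (auto simp: arcs_ends_def arc_to_ends_def)
        have "arc_to_ends K (g a) = arc_to_ends K b"
          using ge[OF a(1)] a xy by (simp add: arc_to_ends_def)
        then have "g a = b" using injK gK[OF a(1)] b by (auto dest: inj_onD)
        then show "b \<in> g ` arcs G" using a by blast
      qed
    qed
    let ?h = "\<lparr> iso_verts = f, iso_arcs = g, iso_head = head K, iso_tail = tail K \<rparr>"
    have "pre_digraph.digraph_isomorphism G ?h"
      using injf injg ge by (auto simp: pre_digraph.digraph_isomorphism_def arc_to_ends_def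
          intro: G.wf_digraph)
    moreover have "K = app_iso ?h G"
      using f surj by (simp add: app_iso_def bij_betw_def)
    ultimately show "digraph_iso G K" unfolding digraph_iso_def by blast
  qed
qed

lemma ex_nat_copy:
  assumes "graph G"
  shows "\<exists>K :: (nat, nat \<times> nat) pre_digraph. graph K \<and> digraph_iso G K"
proof -
  interpret G: graph G by fact
  obtain f :: "'a \<Rightarrow> nat" where f: "inj_on f (verts G)"
    using finite_imp_inj_to_nat_seg[OF G.finite_verts] by blast
  define K where "K = with_proj \<lparr> pverts = f ` verts G, parcs = map_prod f f ` arcs_ends G \<rparr>"
  have sub: "x \<in> verts G \<and> y \<in> verts G \<and> x \<noteq> y \<and> (y, x) \<in> arcs_ends G"
    if "(x, y) \<in> arcs_ends G" for x y
    using that G.sym_arcs G.no_loops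
    by (auto simp: arcs_ends_def arc_to_ends_def symmetric_def dest: symD)
  have "pair_graph \<lparr> pverts = f ` verts G, parcs = map_prod f f ` arcs_ends G \<rparr>"
    apply unfold_locales
    subgoal using sub by auto
    subgoal using sub by auto
    subgoal by simp
    subgoal by (simp add: arcs_ends_def)
    subgoal using sub f by (fastforce dest: inj_onD)
    subgoal unfolding symmetric_def by (rule symI) (use sub in \<open>force simp: image_iff\<close>)
    done
  then have K: "graph K" unfolding K_def by (rule pair_graph.pair_graphD_graph)
  have "digraph_iso G K"
    unfolding digraph_iso_iff[OF assms K]
  proof (intro exI[of _ f] conjI ballI)
    show "bij_betw f (verts G) (verts K)" using f by (simp add: K_def bij_betw_def)
    fix x y assume xy: "x \<in> verts G" "y \<in> verts G"
    have "x = x' \<and> y = y'" if "(x', y') \<in> arcs_ends G" "f x = f x'" "f y = f y'" for x' y'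
      using sub[OF that(1)] that(2,3) xy f by (auto dest: inj_onD)
    then show "x \<rightarrow>\<^bsub>G\<^esub> y \<longleftrightarrow> f x \<rightarrow>\<^bsub>K\<^esub> f y"
      by (auto simp: K_def)
  qed
  with K show ?thesis by blast
qed

lemma iso_class_eq_iff:
  assumes "graph G" "graph K"
  shows "iso_class G = iso_class K \<longleftrightarrow> digraph_iso G K"
proof -
  interpret G: graph G by fact
  interpret K: graph K by fact
  have wf: "wf_digraph G" "wf_digraph K" by unfold_locales
  show ?thesis
  proof
    assume eq: "iso_class G = iso_class K"
    obtain L where L: "L \<in> iso_class G"
      using ex_nat_copy[OF assms(1)] by (auto simp: iso_class_def)
    then have "digraph_iso G L" "digraph_iso K L" using eq by (auto simp: iso_class_def)
    then show "digraph_iso G K"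
      using digraph_iso_trans digraph_iso_swap[OF wf(2)] by metis
  next
    assume GK: "digraph_iso G K"
    then have KG: "digraph_iso K G" using digraph_iso_swap[OF wf(1)] by blast
    have "digraph_iso G L \<longleftrightarrow> digraph_iso K L" for L :: "(nat, nat \<times> nat) pre_digraph"
      using digraph_iso_trans[OF GK, of L] digraph_iso_trans[OF KG, of L] by blast
    then show "iso_class G = iso_class K" by (simp add: iso_class_def)
  qed
qed

lemma deck_cong:
  assumes "graph G" "graph K" "digraph_iso G K"
  shows "deck G = deck K"
proof -
  interpret G: graph G by fact
  interpret K: graph K by fact
  obtain f where f: "bij_betw f (verts G) (verts K)"
    and adj: "\<forall>x\<in>verts G. \<forall>y\<in>verts G. x \<rightarrow>\<^bsub>G\<^esub> y \<longleftrightarrow> f x \<rightarrow>\<^bsub>K\<^esub> f y"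
    using assms digraph_iso_iff by blast
  have "iso_class (pre_digraph.del_vert G x) = iso_class (pre_digraph.del_vert K (f x))"
    if x: "x \<in> verts G" for x
    unfolding iso_class_eq_iff[OF graph_del_vert[OF assms(1)] graph_del_vert[OF assms(2)]]
      digraph_iso_iff[OF graph_del_vert[OF assms(1)] graph_del_vert[OF assms(2)]]
  proof (intro exI[of _ f] conjI ballI)
    show "bij_betw f (verts (pre_digraph.del_vert G x)) (verts (pre_digraph.del_vert K (f x)))"
      using f x by (auto simp: pre_digraph.del_vert_def bij_betw_def inj_on_def)
    fix y z
    assume "y \<in> verts (pre_digraph.del_vert G x)" "z \<in> verts (pre_digraph.del_vert G x)"
    then show "y \<rightarrow>\<^bsub>pre_digraph.del_vert G x\<^esub> z \<longleftrightarrow> f y \<rightarrow>\<^bsub>pre_digraph.del_vert K (f x)\<^esub> f z"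
      using adj f x
      by (auto simp: arcs_ends_del_vert pre_digraph.verts_del_vert bij_betw_def inj_on_def)
  qed
  then have "deck G = {# iso_class (pre_digraph.del_vert K (f x)). x \<in># mset_set (verts G) #}"
    unfolding deck_def by (intro image_mset_cong) simp
  also have "\<dots> = {# iso_class (pre_digraph.del_vert K y). y \<in># image_mset f (mset_set (verts G)) #}"
    by (simp add: image_mset.compositionality comp_def)
  also have "image_mset f (mset_set (verts G)) = mset_set (verts K)"
    using f by (simp add: image_mset_mset_set bij_betw_def)
  finally show ?thesis by (simp add: deck_def)
qed

lemma reconstructibleD:
  fixes G :: "('a, 'b) pre_digraph" and K :: "('c, 'd) pre_digraph"
  assumes "reconstructible G" "graph K" "deck K = deck G"
  shows "digraph_iso K G"
proof -
  obtain L :: "(nat, nat \<times> nat) pre_digraph" where L: "graph L" "digraph_iso K L"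
    using ex_nat_copy[OF assms(2)] by blast
  then have "digraph_iso L G"
    using assms deck_cong[OF assms(2) L] by (auto simp: reconstructible_def)
  with L(2) show ?thesis by (rule digraph_iso_trans)
qed

end

theory Submission
  imports Defs
begin

text \<open>
  Let \<open>K\<close> have the same deck as \<open>G\<close>, and let \<open>s\<close> be a bijection of the vertices that matches each
  card \<open>G \<setminus> x\<close> with an isomorphic card \<open>K \<setminus> s x\<close>. Choose isomorphisms
  \<open>f : G \<setminus> u \<rightarrow> K \<setminus> s u\<close> and \<open>g : G \<setminus> v \<rightarrow> K \<setminus> s v\<close>.

  Since \<open>H\<close> occurs once in \<open>G\<close>, the cards of \<open>G\<close> that contain a copy of \<open>H\<close> are exactly \<open>G \<setminus> u\<close> and
  \<open>G \<setminus> v\<close>, so those of \<open>K\<close> are exactly \<open>K \<setminus> s u\<close> and \<open>K \<setminus> s v\<close>. But the copy \<open>f(H)\<close> of \<open>H\<close> in \<open>K\<close>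
  lies in the card \<open>K \<setminus> f v\<close>, and \<open>f v \<noteq> s u\<close>; hence \<open>f v = s v\<close>. Likewise \<open>g u = s u\<close>, so \<open>f\<close> and
  \<open>g\<close> map \<open>H\<close> onto the same set of vertices (\<open>anchor_card_iso_maps_anchor\<close>).

  On \<open>H\<close>, therefore, \<open>g\<^sup>-\<^sup>1 \<circ> f\<close> is an automorphism. It fixes \<open>N(v) \<inter> V(H)\<close> setwise, so \<open>g\<close>, as well as
  \<open>f\<close>, sends this set to the neighbours of \<open>s v\<close> in the copy of \<open>H\<close>. Extending \<open>g\<close> by \<open>v \<mapsto> s v\<close> thus
  gives a bijection from \<open>G\<close> to \<open>K\<close> that respects the adjacency of every pair other than \<open>{u, v}\<close>.

  This last pair is settled by counting. As \<open>H\<close> is nonempty, \<open>G\<close> has at least three vertices, so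
  the deck determines the number of edges (\<open>card_arcs_ends_eq_if_hypomorphic\<close>), and two graphs with
  equally many edges that agree on all pairs but one agree on that pair too
  (\<open>last_pair_adjacent_iff\<close>).
\<close>

section \<open>Isomorphisms between induced subgraphs\<close>

text \<open>
  The isomorphisms between cards and those between copies of \<open>H\<close> are maps of this kind for different
  vertex sets of the same host graphs. Keeping the hosts fixed makes restricting a map a matter of
  sets only.
\<close>

definition induced_iso ::
  "('a, 'b) pre_digraph \<Rightarrow> 'a set \<Rightarrow> ('c, 'd) pre_digraph \<Rightarrow> 'c set \<Rightarrow> ('a \<Rightarrow> 'c) \<Rightarrow> bool" where
  "induced_iso G A K B f \<longleftrightarrow>
     bij_betw f A B \<and> (\<forall>x\<in>A. \<forall>y\<in>A. x \<rightarrow>\<^bsub>G\<^esub> y \<longleftrightarrow> f x \<rightarrow>\<^bsub>K\<^esub> f y)"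

lemma induced_iso_trans:
  "induced_iso G A K B f \<Longrightarrow> induced_iso K B L C g \<Longrightarrow> induced_iso G A L C (g \<circ> f)"
  by (auto simp: induced_iso_def intro: bij_betw_trans dest: bij_betwE)

lemma induced_iso_inv_into:
  assumes "induced_iso G A K B f"
  shows "induced_iso K B G A (inv_into A f)"
proof -
  have f: "bij_betw f A B" using assms by (simp add: induced_iso_def)
  have "inv_into A f y \<in> A \<and> f (inv_into A f y) = y" if "y \<in> B" for y
    using f that by (auto simp: bij_betw_def inv_into_into f_inv_into_f)
  then show ?thesis
    using assms bij_betw_inv_into[OF f] by (simp add: induced_iso_def)
qed

lemma induced_iso_subset:
  "induced_iso G A K B f \<Longrightarrow> C \<subseteq> A \<Longrightarrow> induced_iso G C K (f ` C) f"
  by (auto simp: induced_iso_def bij_betw_def intro: inj_on_subset)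

lemma graph_induce_subgraph:
  assumes "graph G" "A \<subseteq> verts G"
  shows "graph (G \<restriction> A)"
proof -
  interpret graph G by fact
  have "induced_subgraph (G \<restriction> A) G" using assms(2) by (rule induced_induce)
  then show ?thesis
    by (intro graph.intro pseudo_graph.intro digraphI_induced induced_graph_imp_graph
        digraph.axioms(1)[OF digraphI_induced])
qed

lemma arcs_ends_induce_subgraph: "arcs_ends (G \<restriction> A) = arcs_ends G \<inter> A \<times> A"
  by (auto simp: arcs_ends_def arc_to_ends_def)

lemma del_vert_eq_induce_subgraph:
  assumes "graph G"
  shows "pre_digraph.del_vert G x = G \<restriction> (verts G - {x})"
proof -
  interpret graph G by fact
  show ?thesis by (auto simp: induce_subgraph_def del_vert_def)
qed

lemma digraph_iso_induce_subgraph_iff: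
  assumes "graph G" "graph K" "A \<subseteq> verts G" "B \<subseteq> verts K"
  shows "digraph_iso (G \<restriction> A) (K \<restriction> B) \<longleftrightarrow> (\<exists>f. induced_iso G A K B f)"
proof -
  have "(\<forall>x\<in>A. \<forall>y\<in>A. x \<rightarrow>\<^bsub>G \<restriction> A\<^esub> y \<longleftrightarrow> f x \<rightarrow>\<^bsub>K \<restriction> B\<^esub> f y) \<longleftrightarrow>
        (\<forall>x\<in>A. \<forall>y\<in>A. x \<rightarrow>\<^bsub>G\<^esub> y \<longleftrightarrow> f x \<rightarrow>\<^bsub>K\<^esub> f y)" if "bij_betw f A B" for f
    using that by (auto simp: arcs_ends_induce_subgraph bij_betw_def)
  then show ?thesis
    unfolding digraph_iso_iff[OF graph_induce_subgraph[OF assms(1,3)] graph_induce_subgraph[OF assms(2,4)]]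
      induced_iso_def induce_subgraph_verts
    by blast
qed

text \<open>
  Members of \<open>Aut\<close> come from isomorphisms that also act on arcs. The absence of parallel arcs leaves
  exactly one possible arc map for a given vertex map.
\<close>

lemma ex_Aut_extending:
  assumes "graph H" "induced_iso H (verts H) H (verts H) f"
  shows "\<exists>\<alpha>\<in>Aut H. \<forall>x\<in>verts H. \<alpha> x = f x"
proof -
  interpret graph H by fact
  have f: "bij_betw f (verts H) (verts H)"
    and adj: "\<And>x y. x \<in> verts H \<Longrightarrow> y \<in> verts H \<Longrightarrow> x \<rightarrow>\<^bsub>H\<^esub> y \<longleftrightarrow> f x \<rightarrow>\<^bsub>H\<^esub> f y"
    using assms(2) by (auto simp: induced_iso_def)
  have "\<forall>a\<in>arcs H. \<exists>b\<in>arcs H. tail H b = f (tail H a) \<and> head H b = f (head H a)"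
  proof
    fix a assume a: "a \<in> arcs H"
    then have "tail H a \<rightarrow>\<^bsub>H\<^esub> head H a" by (auto simp: arcs_ends_def arc_to_ends_def)
    then have "f (tail H a) \<rightarrow>\<^bsub>H\<^esub> f (head H a)" using adj a by simp
    then show "\<exists>b\<in>arcs H. tail H b = f (tail H a) \<and> head H b = f (head H a)"
      by (auto simp: arcs_ends_def arc_to_ends_def)
  qed
  then obtain g where g: "\<And>a. a \<in> arcs H \<Longrightarrow>
      g a \<in> arcs H \<and> tail H (g a) = f (tail H a) \<and> head H (g a) = f (head H a)"
    by metis
  have "inj_on g (arcs H)"
  proof (rule inj_onI)
    fix a b assume ab: "a \<in> arcs H" "b \<in> arcs H" "g a = g b"
    then have "f (tail H a) = f (tail H b)" "f (head H a) = f (head H b)" using g by metis+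
    then have "tail H a = tail H b" "head H a = head H b"
      using f ab by (auto simp: bij_betw_def dest: inj_onD)
    then show "a = b" using ab no_multi_arcs by (auto simp: arc_to_ends_def)
  qed
  moreover from this have "g ` arcs H = arcs H"
    using g by (intro endo_inj_surj) auto
  moreover define h where "h = \<lparr> iso_verts = f, iso_arcs = g, iso_head = head H, iso_tail = tail H \<rparr>"
  ultimately have "digraph_isomorphism h" "app_iso h H = H"
    using f g by (auto simp: digraph_isomorphism_def app_iso_def bij_betw_def intro: wf_digraph)
  then have "f \<in> Aut H" unfolding Aut_def h_def by force
  then show ?thesis by blast
qed

section \<open>What the deck determines\<close>

lemma bij_betw_fun_upd_insert:
  "bij_betw f A B \<Longrightarrow> a \<notin> A \<Longrightarrow> b \<notin> B \<Longrightarrow> bij_betw (f(a := b)) (insert a A) (insert b B)"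
  by (auto simp: bij_betw_def inj_on_def)

lemma bij_betw_if_image_mset_eq:
  assumes "finite A" "finite B" "image_mset p (mset_set A) = image_mset q (mset_set B)"
  shows "\<exists>s. bij_betw s A B \<and> (\<forall>x\<in>A. p x = q (s x))"
  using assms
proof (induction A arbitrary: B rule: finite_induct)
  case empty
  then have "B = {}" by (simp add: mset_set_empty_iff)
  then show ?case by (simp add: bij_betw_def)
next
  case (insert a A)
  then have "p a \<in># image_mset q (mset_set B)"
    by (metis image_eqI finite.insertI finite_set_mset_mset_set insertI1 set_image_mset)
  then obtain b where b: "b \<in> B" "p a = q b" using insert.prems by auto
  have "mset_set B = add_mset b (mset_set (B - {b}))"
    using b(1) insert.prems(1) by (simp add: mset_set.remove)
  then have "image_mset p (mset_set A) = image_mset q (mset_set (B - {b}))"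
    using insert b by simp
  then obtain s where s: "bij_betw s A (B - {b})" "\<forall>x\<in>A. p x = q (s x)"
    using insert.IH[of "B - {b}"] insert.prems(1) by auto
  have "bij_betw (s(a := b)) (insert a A) (insert b (B - {b}))"
    using s(1) insert.hyps(2) by (intro bij_betw_fun_upd_insert) auto
  then have "bij_betw (s(a := b)) (insert a A) B" using b(1) by (simp add: insert_absorb)
  moreover have "\<forall>x\<in>insert a A. p x = q ((s(a := b)) x)"
    using s(2) b(2) insert.hyps(2) by auto
  ultimately show ?case by blast
qed

text \<open>
  Working with a bijection between the vertices instead of an equality of multisets makes it
  possible to say which card of \<open>K\<close> corresponds to which card of \<open>G\<close>.
\<close>

lemma deck_eq_imp_hypomorphism:
  assumes "graph G" "graph K" "deck G = deck K"
  shows "\<exists>s. bij_betw s (verts G) (verts K) \<and>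
    (\<forall>x\<in>verts G. \<exists>f. induced_iso G (verts G - {x}) K (verts K - {s x}) f)"
proof -
  interpret G: graph G by fact
  interpret K: graph K by fact
  obtain s where s: "bij_betw s (verts G) (verts K)"
    and cls: "\<forall>x\<in>verts G.
      iso_class (pre_digraph.del_vert G x) = iso_class (pre_digraph.del_vert K (s x))"
    using bij_betw_if_image_mset_eq[OF G.finite_verts K.finite_verts assms(3)[unfolded deck_def]]
    by blast
  have "\<exists>f. induced_iso G (verts G - {x}) K (verts K - {s x}) f" if "x \<in> verts G" for x
    using cls that
      iso_class_eq_iff[OF graph_del_vert[OF assms(1)] graph_del_vert[OF assms(2)], of x "s x"]
    by (simp add: del_vert_eq_induce_subgraph[OF assms(1)] del_vert_eq_induce_subgraph[OF assms(2)]
        digraph_iso_induce_subgraph_iff[OF assms(1,2)])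
  with s show ?thesis by blast
qed

lemma card_arcs_ends_induced_iso:
  assumes "induced_iso G A K B f"
  shows "card (arcs_ends G \<inter> A \<times> A) = card (arcs_ends K \<inter> B \<times> B)"
proof (rule bij_betw_same_card)
  have inj: "inj_on f A" and B: "B = f ` A" using assms by (auto simp: induced_iso_def bij_betw_def)
  show "bij_betw (map_prod f f) (arcs_ends G \<inter> A \<times> A) (arcs_ends K \<inter> B \<times> B)"
    unfolding bij_betw_def
  proof
    show "inj_on (map_prod f f) (arcs_ends G \<inter> A \<times> A)"
      using map_prod_inj_on[OF inj inj] by (rule inj_on_subset) blast
    show "map_prod f f ` (arcs_ends G \<inter> A \<times> A) = arcs_ends K \<inter> B \<times> B"
      using assms by (force simp: induced_iso_def B image_iff)
  qed
qed

text \<open>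
  Kelly's counting argument for edges: an arc survives in every card except the two obtained by
  deleting one of its ends.
\<close>

lemma sum_card_arcs_ends_del_vert:
  assumes "graph G"
  shows "(\<Sum>x\<in>verts G. card (arcs_ends G \<inter> (verts G - {x}) \<times> (verts G - {x}))) =
    (card (verts G) - 2) * card (arcs_ends G)"
proof -
  interpret graph G by fact
  have sub: "a \<in> verts G \<and> b \<in> verts G \<and> a \<noteq> b" if "(a, b) \<in> arcs_ends G" for a b
    using that no_loops by (auto simp: arcs_ends_def arc_to_ends_def)
  have fin: "finite (arcs_ends G)" by (simp add: arcs_ends_def)
  have cnt: "\<forall>e\<in>arcs_ends G. card {x \<in> verts G. fst e \<noteq> x \<and> snd e \<noteq> x} = card (verts G) - 2"
  proof
    fix e assume e: "e \<in> arcs_ends G"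
    have "{x \<in> verts G. fst e \<noteq> x \<and> snd e \<noteq> x} = verts G - {fst e, snd e}" by auto
    then show "card {x \<in> verts G. fst e \<noteq> x \<and> snd e \<noteq> x} = card (verts G) - 2"
      using sub[of "fst e" "snd e"] e by (simp add: card_Diff_subset)
  qed
  have "arcs_ends G \<inter> (verts G - {x}) \<times> (verts G - {x}) =
      {e \<in> arcs_ends G. fst e \<noteq> x \<and> snd e \<noteq> x}" for x
    using sub by auto
  then show ?thesis using sum_multicount[OF finite_verts fin cnt] by simp
qed

lemma card_arcs_ends_eq_if_hypomorphic:
  assumes "graph G" "graph K" "card (verts G) > 2"
    and s: "bij_betw s (verts G) (verts K)"
    and cards: "\<And>x. x \<in> verts G \<Longrightarrow> \<exists>f. induced_iso G (verts G - {x}) K (verts K - {s x}) f"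
  shows "card (arcs_ends G) = card (arcs_ends K)"
proof -
  have "(card (verts G) - 2) * card (arcs_ends G) =
      (\<Sum>x\<in>verts G. card (arcs_ends K \<inter> (verts K - {s x}) \<times> (verts K - {s x})))"
    unfolding sum_card_arcs_ends_del_vert[OF assms(1), symmetric]
    using cards by (intro sum.cong refl) (blast intro: card_arcs_ends_induced_iso)
  also have "\<dots> = (\<Sum>y\<in>verts K. card (arcs_ends K \<inter> (verts K - {y}) \<times> (verts K - {y})))"
    by (rule sum.reindex_bij_betw[OF s])
  also have "\<dots> = (card (verts G) - 2) * card (arcs_ends K)"
    using bij_betw_same_card[OF s] by (simp add: sum_card_arcs_ends_del_vert[OF assms(2)])
  finally show ?thesis using assms(3) by simp
qed

text \<open>
  The arcs that do not join \<open>u\<close> and \<open>v\<close> correspond under \<open>h\<close> to arcs of \<open>K\<close>. What is left of the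
  total is 2 or 0 in each graph, according to whether the last pair is adjacent.
\<close>

lemma last_pair_adjacent_iff:
  assumes "graph G" "graph K" and h: "bij_betw h (verts G) (verts K)"
    and uv: "u \<in> verts G" "v \<in> verts G" "u \<noteq> v"
    and adj: "\<And>x y. x \<in> verts G \<Longrightarrow> y \<in> verts G \<Longrightarrow> {x, y} \<noteq> {u, v} \<Longrightarrow>
      x \<rightarrow>\<^bsub>G\<^esub> y \<longleftrightarrow> h x \<rightarrow>\<^bsub>K\<^esub> h y"
    and card_eq: "card (arcs_ends G) = card (arcs_ends K)"
  shows "u \<rightarrow>\<^bsub>G\<^esub> v \<longleftrightarrow> h u \<rightarrow>\<^bsub>K\<^esub> h v"
proof -
  interpret G: graph G by fact
  interpret K: graph K by fact
  have inj: "inj_on h (verts G)" and V: "verts K = h ` verts G" using h by (auto simp: bij_betw_def)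
  define P where "P = {(u, v), (v, u)}"
  define Q where "Q = {(h u, h v), (h v, h u)}"
  have symG: "(v, u) \<in> arcs_ends G \<longleftrightarrow> (u, v) \<in> arcs_ends G"
    using G.sym_arcs by (auto simp: symmetric_def dest: symD)
  have symK: "(h v, h u) \<in> arcs_ends K \<longleftrightarrow> (h u, h v) \<in> arcs_ends K"
    using K.sym_arcs by (auto simp: symmetric_def dest: symD)
  have subG: "arcs_ends G \<subseteq> verts G \<times> verts G" and subK: "arcs_ends K \<subseteq> verts K \<times> verts K"
    by (auto simp: arcs_ends_def arc_to_ends_def)
  have fin: "finite (arcs_ends G)" "finite (arcs_ends K)" by (simp_all add: arcs_ends_def)
  have "bij_betw (map_prod h h) (arcs_ends G - P) (arcs_ends K - Q)"
    unfolding bij_betw_def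
  proof
    show "inj_on (map_prod h h) (arcs_ends G - P)"
      using map_prod_inj_on[OF inj inj] by (rule inj_on_subset) (use subG in blast)
    have PQ: "(h x, h y) \<in> Q \<longleftrightarrow> (x, y) \<in> P" if "x \<in> verts G" "y \<in> verts G" for x y
      using that uv inj by (auto simp: P_def Q_def dest: inj_onD)
    have adj': "(x, y) \<in> arcs_ends G \<longleftrightarrow> (h x, h y) \<in> arcs_ends K"
      if "x \<in> verts G" "y \<in> verts G" "(x, y) \<notin> P" for x y
      using adj[of x y] that by (auto simp: P_def doubleton_eq_iff)
    show "map_prod h h ` (arcs_ends G - P) = arcs_ends K - Q"
    proof (intro set_eqI iffI)
      fix e assume "e \<in> map_prod h h ` (arcs_ends G - P)"
      then show "e \<in> arcs_ends K - Q" using subG PQ adj' by fastforce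
    next
      fix e assume e: "e \<in> arcs_ends K - Q"
      then obtain x y where xy: "x \<in> verts G" "y \<in> verts G" "e = (h x, h y)"
        using subK V by fastforce
      then have "(x, y) \<in> arcs_ends G - P" using e PQ adj' by auto
      then show "e \<in> map_prod h h ` (arcs_ends G - P)" using xy(3) by force
    qed
  qed
  then have rest: "card (arcs_ends G - P) = card (arcs_ends K - Q)" by (rule bij_betw_same_card)
  have "card (arcs_ends G) = card (arcs_ends G - P) + (if (u, v) \<in> arcs_ends G then 2 else 0)"
  proof (cases "(u, v) \<in> arcs_ends G")
    case True
    then have "P \<subseteq> arcs_ends G" "card P = 2" using symG uv by (auto simp: P_def)
    then show ?thesis using True card_Diff_subset[of P "arcs_ends G"] card_mono[OF fin(1), of P]
      by (simp add: P_def)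
  next
    case False
    then have "arcs_ends G - P = arcs_ends G" using symG by (auto simp: P_def)
    then show ?thesis using False by simp
  qed
  moreover have "h u \<noteq> h v" using inj uv by (auto dest: inj_onD)
  have "card (arcs_ends K) = card (arcs_ends K - Q) + (if (h u, h v) \<in> arcs_ends K then 2 else 0)"
  proof (cases "(h u, h v) \<in> arcs_ends K")
    case True
    then have "Q \<subseteq> arcs_ends K" "card Q = 2" using symK \<open>h u \<noteq> h v\<close> by (auto simp: Q_def)
    then show ?thesis using True card_Diff_subset[of Q "arcs_ends K"] card_mono[OF fin(2), of Q]
      by (simp add: Q_def)
  next
    case False
    then have "arcs_ends K - Q = arcs_ends K" using symK by (auto simp: Q_def)
    then show ?thesis using False by simp
  qed
  ultimately show ?thesis using rest card_eq by (auto split: if_splits)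
qed

section \<open>Anchors with two missing vertices\<close>

text \<open>
  The image of the anchor avoids \<open>f b\<close>, so it survives in the card of \<open>K\<close> at \<open>f b\<close>, which is a card
  of \<open>G\<close> at some vertex \<open>x\<close>. Pulled back, it is a copy of the anchor in \<open>G \<setminus> x\<close>, hence the anchor
  itself, so \<open>x\<close> lies outside the anchor. This leaves \<open>x = b\<close>, because \<open>x = a\<close> would give
  \<open>f b = s a\<close>, a vertex missing from the range of \<open>f\<close>.
\<close>

lemma anchor_card_iso_maps_anchor:
  assumes G: "graph G"
    and s: "bij_betw s (verts G) (verts K)"
    and cards: "\<And>x. x \<in> verts G \<Longrightarrow> \<exists>f. induced_iso G (verts G - {x}) K (verts K - {s x}) f"
    and W: "W = verts G - {a, b}" and ab: "a \<in> verts G" "b \<in> verts G" "a \<noteq> b"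
    and unique: "\<And>U e. U \<subseteq> verts G \<Longrightarrow> induced_iso G W G U e \<Longrightarrow> U = W"
    and f: "induced_iso G (verts G - {a}) K (verts K - {s a}) f"
  shows "f b = s b" and "f ` W = verts K - {s a, s b}"
proof -
  have inj: "inj_on f (verts G - {a})" and im: "f ` (verts G - {a}) = verts K - {s a}"
    using f by (auto simp: induced_iso_def bij_betw_def)
  have fb: "f b \<in> verts K" "f b \<noteq> s a" using im ab by auto
  then obtain x where x: "x \<in> verts G" "s x = f b"
    using s unfolding bij_betw_def by (metis imageE)
  have fW: "f ` W = verts K - {s a} - {f b}"
  proof -
    have "W = (verts G - {a}) - {b}" using W by auto
    then show ?thesis using inj im ab by (simp add: inj_on_image_set_diff[of f "verts G - {a}"])
  qed
  have "x = b"
  proof (rule ccontr)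
    assume "x \<noteq> b"
    then have "x \<in> W" using W x fb(2) by auto
    obtain g where g: "induced_iso G (verts G - {x}) K (verts K - {s x}) g" using cards x by blast
    define e where "e = inv_into (verts G - {x}) g"
    have e: "induced_iso K (verts K - {s x}) G (verts G - {x}) e"
      unfolding e_def by (rule induced_iso_inv_into[OF g])
    have "f ` W \<subseteq> verts K - {s x}" using fW x by auto
    then have sub: "e ` f ` W \<subseteq> verts G - {x}" and e': "induced_iso K (f ` W) G (e ` f ` W) e"
      using e induced_iso_subset[OF e] unfolding induced_iso_def bij_betw_def by blast+
    have "induced_iso G W K (f ` W) f" by (rule induced_iso_subset[OF f]) (auto simp: W)
    then have "induced_iso G W G (e ` f ` W) (e \<circ> f)" using e' by (rule induced_iso_trans)
    then have "e ` f ` W = W" using sub unique by blast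
    then show False using sub \<open>x \<in> W\<close> by auto
  qed
  then show "f b = s b" using x by simp
  then show "f ` W = verts K - {s a, s b}" using fW by auto
qed

theorem theorem4:
  fixes G H :: "('a, 'b) pre_digraph" and u v :: 'a
  assumes "graph G"
    and "u \<in> verts G" and "v \<in> verts G" and "u \<noteq> v"
    and "H = G \<restriction> (verts G - {v, u})"
    and "anchor G H"
    and "\<And>\<alpha>. \<alpha> \<in> Aut H \<Longrightarrow> \<alpha> ` (neighbors G v \<inter> verts H) = neighbors G v \<inter> verts H"
  shows "reconstructible G"
  unfolding reconstructible_def
proof (intro allI impI)
  fix K :: "(nat, nat \<times> nat) pre_digraph"
  assume K: "graph K \<and> deck K = deck G"
  then have gK: "graph K" by simp
  interpret G: graph G by fact
  interpret K: graph K by fact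
  define W where "W = verts G - {v, u}"
  define N where "N = neighbors G v \<inter> W"
  have H: "H = G \<restriction> W" "verts H = W" using assms(5) by (auto simp: W_def)
  have gH: "graph H" unfolding H(1) by (rule graph_induce_subgraph) (use assms(1) W_def in auto)
  have Wsub: "W \<subseteq> verts G" by (auto simp: W_def)
  have unique: "U = W" if "U \<subseteq> verts G" "induced_iso G W G U e" for U e
  proof -
    have "digraph_iso (G \<restriction> U) H"
      unfolding H(1) digraph_iso_induce_subgraph_iff[OF assms(1,1) that(1) Wsub]
      using induced_iso_inv_into[OF that(2)] by blast
    then show ?thesis using assms(6) that(1) H(2) by (auto simp: anchor_def)
  qed
  obtain s where s: "bij_betw s (verts G) (verts K)"
    and cards: "\<And>x. x \<in> verts G \<Longrightarrow> \<exists>f. induced_iso G (verts G - {x}) K (verts K - {s x}) f"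
    using deck_eq_imp_hypomorphism[OF assms(1) gK] K by metis
  obtain f where f: "induced_iso G (verts G - {u}) K (verts K - {s u}) f"
    using cards assms(2) by blast
  obtain g where g: "induced_iso G (verts G - {v}) K (verts K - {s v}) g"
    using cards assms(3) by blast
  have W': "W = verts G - {u, v}" by (auto simp: W_def)
  have fv: "f v = s v" and fW: "f ` W = verts K - {s u, s v}"
    using anchor_card_iso_maps_anchor[OF assms(1) s cards W' assms(2,3,4) unique f] by auto
  have gu: "g u = s u" and gW: "g ` W = verts K - {s u, s v}"
    using anchor_card_iso_maps_anchor[OF assms(1) s cards W_def assms(3,2) assms(4)[symmetric] unique g]
    by auto
  have fWiso: "induced_iso G W K (g ` W) f"
    using induced_iso_subset[OF f, of W] fW gW by (auto simp: W_def)
  have gWiso: "induced_iso G W K (g ` W) g"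
    by (rule induced_iso_subset[OF g]) (auto simp: W_def)
  have injg: "inj_on g W" using gWiso by (simp add: induced_iso_def bij_betw_def)
  \<comment> \<open>the only use of the invariance of the neighbourhood under automorphisms\<close>
  have fN: "f ` N = g ` N"
  proof -
    let ?\<phi> = "inv_into W g \<circ> f"
    have "induced_iso G W G W ?\<phi>"
      by (rule induced_iso_trans[OF fWiso induced_iso_inv_into[OF gWiso]])
    then have "induced_iso H (verts H) H (verts H) ?\<phi>"
      unfolding H by (auto simp: induced_iso_def arcs_ends_induce_subgraph dest: bij_betwE)
    then obtain \<alpha> where \<alpha>: "\<alpha> \<in> Aut H" "\<forall>x\<in>W. \<alpha> x = ?\<phi> x"
      using ex_Aut_extending[OF gH] H(2) by blast
    have "\<alpha> ` N = N" using assms(7)[OF \<alpha>(1)] by (simp add: N_def H(2))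
    moreover have "g (\<alpha> x) = f x" if "x \<in> W" for x
    proof -
      have "f x \<in> g ` W" using that fW gW by blast
      then show ?thesis using \<alpha>(2) that by (simp add: f_inv_into_f)
    qed
    moreover have "N \<subseteq> W" by (simp add: N_def)
    ultimately show ?thesis by (metis (no_types, lifting) image_cong image_image subsetD)
  qed
  define h where "h = g(v := s v)"
  have hv: "h v = s v" and hg: "\<And>x. x \<noteq> v \<Longrightarrow> h x = g x" by (auto simp: h_def)
  have hbij: "bij_betw h (verts G) (verts K)"
  proof -
    have "bij_betw g (verts G - {v}) (verts K - {s v})" using g by (simp add: induced_iso_def)
    then have "bij_betw h (insert v (verts G - {v})) (insert (s v) (verts K - {s v}))"
      unfolding h_def by (intro bij_betw_fun_upd_insert) auto
    moreover have "s v \<in> verts K" using s assms(3) by (auto simp: bij_betw_def)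
    ultimately show ?thesis using assms(3) by (simp add: insert_absorb)
  qed
  have adj_sym_G: "x \<rightarrow>\<^bsub>G\<^esub> y \<longleftrightarrow> y \<rightarrow>\<^bsub>G\<^esub> x" for x y
    using G.sym_arcs by (auto simp: symmetric_def dest: symD)
  have adj_sym_K: "x \<rightarrow>\<^bsub>K\<^esub> y \<longleftrightarrow> y \<rightarrow>\<^bsub>K\<^esub> x" for x y
    using K.sym_arcs by (auto simp: symmetric_def dest: symD)
  have adj_irrefl: "\<not> x \<rightarrow>\<^bsub>G\<^esub> x" "\<not> y \<rightarrow>\<^bsub>K\<^esub> y" for x y
    using G.no_loops K.no_loops by (auto simp: arcs_ends_def arc_to_ends_def)
  \<comment> \<open>\<open>f\<close> knows the neighbours of \<open>v\<close> but \<open>h\<close> follows \<open>g\<close> on the anchor; \<open>fN\<close> reconciles the two\<close>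
  have adj_v: "v \<rightarrow>\<^bsub>G\<^esub> y \<longleftrightarrow> h v \<rightarrow>\<^bsub>K\<^esub> h y" if y: "y \<in> W" for y
  proof -
    obtain z where z: "z \<in> W" "g y = f z" using y fW gW by blast
    have "v \<rightarrow>\<^bsub>G\<^esub> y \<longleftrightarrow> y \<in> N" using y by (simp add: N_def neighbors_def)
    also have "\<dots> \<longleftrightarrow> g y \<in> g ` N"
      using inj_on_image_mem_iff[OF injg y, of N] by (simp add: N_def)
    also have "\<dots> \<longleftrightarrow> f z \<in> f ` N" by (simp add: fN z)
    also have "\<dots> \<longleftrightarrow> z \<in> N"
      using fWiso z by (intro inj_on_image_mem_iff[of f W]) (auto simp: N_def induced_iso_def bij_betw_def)
    also have "\<dots> \<longleftrightarrow> v \<rightarrow>\<^bsub>G\<^esub> z" using z by (simp add: N_def neighbors_def)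
    also have "\<dots> \<longleftrightarrow> f v \<rightarrow>\<^bsub>K\<^esub> f z"
      using f z assms(3,4) by (auto simp: induced_iso_def W_def)
    also have "\<dots> \<longleftrightarrow> h v \<rightarrow>\<^bsub>K\<^esub> h y"
      using y hg[of y] by (auto simp: fv hv z(2) W_def)
    finally show ?thesis .
  qed
  have adj: "x \<rightarrow>\<^bsub>G\<^esub> y \<longleftrightarrow> h x \<rightarrow>\<^bsub>K\<^esub> h y"
    if xy: "x \<in> verts G" "y \<in> verts G" "{x, y} \<noteq> {u, v}" for x y
  proof -
    consider "x \<noteq> v" "y \<noteq> v" | "x = v" "y = v" | "x = v" "y \<in> W" | "y = v" "x \<in> W"
      using xy by (auto simp: W_def)
    then show ?thesis
    proof cases
      case 1
      then show ?thesis using g xy by (simp add: hg induced_iso_def)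
    next
      case 2
      then show ?thesis by (simp add: adj_irrefl)
    next
      case 3
      then show ?thesis by (simp add: adj_v)
    next
      case 4
      then show ?thesis using adj_v[of x] adj_sym_G[of x y] adj_sym_K[of "h x" "h y"] by simp
    qed
  qed
  have "card (verts G) > 2"
  proof -
    have "W \<noteq> {}" using assms(6) H(2) by (simp add: anchor_def)
    then have "card W > 0" by (simp add: W_def card_gt_0_iff)
    moreover have "card W = card (verts G) - 2"
      using assms(2,3,4) by (simp add: W' card_Diff_subset)
    ultimately show ?thesis by simp
  qed
  then have "card (arcs_ends G) = card (arcs_ends K)"
    by (rule card_arcs_ends_eq_if_hypomorphic[OF assms(1) gK _ s cards])
  then have uv: "u \<rightarrow>\<^bsub>G\<^esub> v \<longleftrightarrow> h u \<rightarrow>\<^bsub>K\<^esub> h v"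
    using last_pair_adjacent_iff[OF assms(1) gK hbij assms(2-4) adj] by blast
  have "x \<rightarrow>\<^bsub>G\<^esub> y \<longleftrightarrow> h x \<rightarrow>\<^bsub>K\<^esub> h y" if "x \<in> verts G" "y \<in> verts G" for x y
    using adj[OF that] uv adj_sym_G[of u v] adj_sym_K[of "h u" "h v"]
    by (auto simp: doubleton_eq_iff)
  then have "digraph_iso G K" unfolding digraph_iso_iff[OF assms(1) gK] using hbij by blast
  moreover have "wf_digraph G" by unfold_locales
  ultimately show "digraph_iso K G" by (simp add: digraph_iso_swap)
qed

end
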